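(* Let $\mathbb{T}=\mathbb{R}/2\pi\mathbb{Z}$. For every $\alpha\in(0,1)$ and every $T>0$, the following assertion is false: for every subset $E\subset\mathbb{T}$ with $C^{\alpha}_{\mathcal{H}}(E)>0$ there is a constant $C_{obs}>0$ such that for all $u_0\in C^\infty(\mathbb{T})$ the solution $u$ of the Schrödinger equation $$i\partial_t u(t,x)+\partial_x^2u(t,x)=0,\quad t>0,\ x\in\mathbb{T},\qquad u(0,\cdot)=u_0,$$ satisfies $$\|u(T,\cdot)\|_{L^2(\mathbb{T})}\le C_{obs}\int_0^T\sup_{x\in E}|u(t,x)|\,dt .$$
   Context: $\mathbb{T}$ is identified with $[0,2\pi)$ with periodic boundary conditions, and subsets of $\mathbb{T}$ are regarded as subsets of $[0,2\pi)\subset\mathbb{R}$. For $\alpha>0$, the $\alpha$-Hausdorff content of a set $E\subset\mathbb{R}$ is $$C^{\alpha}_{\mathcal{H}}(E)=\inf\Big\{\sum_j r_j^{\alpha}: E\subset\bigcup_j B(x_j,r_j)\Big\},$$ where the infimum is over countable covers of $E$ by balls $B(x_j,r_j)$ (center $x_j$, radius $r_j$). *)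

theory Defs
  imports "HOL-Analysis.Analysis"
begin

text \<open>
  A zero radius is allowed: the ball is then empty and contributes \<open>0 powr \<alpha> = 0\<close>, so sequences
  indexed by the natural numbers also account for finite covers.
\<close>

definition hausdorff_content :: "real \<Rightarrow> real set \<Rightarrow> ennreal" where
  "hausdorff_content \<alpha> E =
     (INF (x, r) \<in> {(x :: nat \<Rightarrow> real, r :: nat \<Rightarrow> real).
                     (\<forall>j. 0 \<le> r j) \<and> E \<subseteq> (\<Union>j. ball (x j) (r j))}.
        \<Sum>j. ennreal (r j powr \<alpha>))"

text \<open>Functions on the torus are represented by \<open>2\<pi>\<close>-periodic functions on the real line.\<close>

definition torus_fun :: "(real \<Rightarrow> complex) \<Rightarrow> bool" where
  "torus_fun f \<longleftrightarrow> (\<forall>x. f (x + 2 * pi) = f x)"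

text \<open>In the following definition, \<open>D n\<close> is the \<open>n\<close>-th derivative of \<open>f\<close>.\<close>

definition smooth_torus_fun :: "(real \<Rightarrow> complex) \<Rightarrow> bool" where
  "smooth_torus_fun f \<longleftrightarrow> torus_fun f \<and>
     (\<exists>D :: nat \<Rightarrow> real \<Rightarrow> complex. D 0 = f \<and>
        (\<forall>n x. (D n has_vector_derivative D (Suc n) x) (at x)))"

definition torus_L2_norm :: "(real \<Rightarrow> complex) \<Rightarrow> real" where
  "torus_L2_norm f = sqrt (integral {0..2 * pi} (\<lambda>x. (cmod (f x))\<^sup>2))"

text \<open>
  Classical solutions: continuous up to \<open>t = 0\<close>, with continuous \<open>u\<^sub>t\<close>, \<open>u\<^sub>x\<close>, \<open>u\<^sub>x\<^sub>x\<close> for \<open>t > 0\<close>.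
  For smooth initial data there is exactly one solution in this class (compare Fourier
  coefficients), and it is smooth. Values of \<open>u\<close> at negative times are irrelevant.
\<close>

definition schroedinger_solution ::
    "(real \<Rightarrow> complex) \<Rightarrow> (real \<Rightarrow> real \<Rightarrow> complex) \<Rightarrow> bool" where
  "schroedinger_solution u0 u \<longleftrightarrow>
     (\<forall>t\<ge>0. torus_fun (u t)) \<and>
     continuous_on ({0..} \<times> UNIV) (\<lambda>(t, x). u t x) \<and>
     (\<forall>x. u 0 x = u0 x) \<and>
     (\<exists>ut ux uxx :: real \<Rightarrow> real \<Rightarrow> complex.
        continuous_on ({0<..} \<times> UNIV) (\<lambda>(t, x). ut t x) \<and>
        continuous_on ({0<..} \<times> UNIV) (\<lambda>(t, x). ux t x) \<and>
        continuous_on ({0<..} \<times> UNIV) (\<lambda>(t, x). uxx t x) \<and>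
        (\<forall>t>0. \<forall>x.
           ((\<lambda>s. u s x) has_vector_derivative ut t x) (at t) \<and>
           (u t has_vector_derivative ux t x) (at x) \<and>
           (ux t has_vector_derivative uxx t x) (at x) \<and>
           \<i> * ut t x + uxx t x = 0))"

end

theory Submission
  imports Defs
begin

text \<open>
  The stationary solutions \<open>exp (- \<i> n\<^sup>2 t) sin (n x)\<close> have constant \<open>L\<^sup>2\<close> norm but are uniformly small on
  every set lying close to \<open>(\<pi> / n) \<int>\<close>. A Cantor set whose points have arbitrarily long blocks of
  zero binary digits, placed extremely sparsely, lies close to \<open>(\<pi> / n) \<int>\<close> for arbitrarily large \<open>n\<close>
  with vanishing relative error, so it violates every observability estimate. It still has positive
  content: it is the image of the unit interval under a map \<open>f\<close> with
  \<open>\<bar>f s - f t\<bar> \<ge> c \<bar>s - t\<bar> powr (1 / \<alpha>)\<close>, so any cover of it by balls pulls back to a cover of the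
  unit interval.
\<close>

section \<open>The zero-inserting map and its estimates\<close>

definition level :: "nat \<Rightarrow> nat \<Rightarrow> real \<Rightarrow> real" where
  "level p k s = of_int \<lfloor>2 ^ (p * k\<^sup>2) * s\<rfloor> / 2 ^ (p * k\<^sup>2)"

text \<open>Consecutive truncations \<open>level p k s\<close> and \<open>level p (Suc k) s\<close>
  differ by the block of binary digits p k^2 + 1 to p (k+1)^2. The tail of the weights from
  \<open>J\<close> on telescopes to (1/2)^(J^2), so \<open>spread\<close> moves the block with index
  k to the right by k^2 places.\<close>

definition gap :: "nat \<Rightarrow> real" where
  "gap k = (1/2) ^ (k\<^sup>2) - (1/2) ^ ((Suc k)\<^sup>2)"

text \<open>
  Up to the factor \<open>2 \<pi>\<close> this is the parametrization of the Cantor set: it inserts \<open>2 k + 1\<close> zeros into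
  the binary expansion of \<open>s\<close> after its digit number \<open>p (k + 1)\<^sup>2\<close>. Summation by parts turns the
  digit sum into a combination of the truncations \<open>level\<close> with nonnegative coefficients, which makes
  the lower bound on differences immediate.
\<close>

definition spread :: "nat \<Rightarrow> real \<Rightarrow> real" where
  "spread p s = (\<Sum>k. gap k * level p (Suc k) s)"

lemma gap_nonneg: "0 \<le> gap k"
  unfolding gap_def by (simp add: power_decreasing)

lemma gap_sums: "(\<lambda>k. gap (k + J)) sums (1/2) ^ (J\<^sup>2)"
proof -
  have "(\<lambda>k. (1/2::real) ^ k) \<longlonglongrightarrow> 0"
    by (intro LIMSEQ_power_zero) simp
  moreover have "filterlim (\<lambda>k. (k + J)\<^sup>2) at_top sequentially"
    by (rule filterlim_at_top_mono[OF filterlim_ident])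
       (auto intro!: eventually_sequentiallyI[of 0] order.trans[OF le_add1 le_square[folded power2_eq_square]])
  ultimately have "(\<lambda>k. (1/2::real) ^ ((k + J)\<^sup>2)) \<longlonglongrightarrow> 0"
    by (rule filterlim_compose)
  from telescope_sums'[OF this] show ?thesis
    by (simp add: gap_def)
qed

lemma level_le: "level p k s \<le> s"
  unfolding level_def by (simp add: divide_le_eq mult.commute)

lemma level_ge: "s - 1 / 2 ^ (p * k\<^sup>2) \<le> level p k s"
proof -
  have "2 ^ (p * k\<^sup>2) * s - 1 \<le> of_int \<lfloor>2 ^ (p * k\<^sup>2) * s\<rfloor>"
    by linarith
  then have "(2 ^ (p * k\<^sup>2) * s - 1) / 2 ^ (p * k\<^sup>2) \<le> level p k s"
    unfolding level_def by (intro divide_right_mono) auto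
  then show ?thesis
    by (simp add: diff_divide_distrib)
qed

lemma level_mono: "t \<le> s \<Longrightarrow> level p k t \<le> level p k s"
  unfolding level_def by (intro divide_right_mono) (auto intro!: floor_mono)

lemma level_nonneg: "0 \<le> s \<Longrightarrow> 0 \<le> level p k s"
  unfolding level_def by simp

lemma summable_spread:
  assumes "0 \<le> s"
  shows "summable (\<lambda>k. gap k * level p (Suc k) s)"
proof (rule summable_comparison_test')
  show "summable (\<lambda>k. gap k * s)"
    using gap_sums[of 0] by (intro summable_mult2) (simp add: sums_iff)
  show "norm (gap k * level p (Suc k) s) \<le> gap k * s" if "0 \<le> k" for k
    using assms by (simp add: abs_mult gap_nonneg level_nonneg level_le mult_left_mono)
qed

lemma spread_nonneg: "0 \<le> s \<Longrightarrow> 0 \<le> spread p s"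
  unfolding spread_def
  by (intro suminf_nonneg summable_spread) (auto intro: mult_nonneg_nonneg gap_nonneg level_nonneg)

lemma spread_le:
  assumes "0 \<le> s"
  shows "spread p s \<le> s"
proof -
  have gap_s: "(\<lambda>k. gap k * s) sums s"
    using sums_mult2[OF gap_sums[of 0], of s] by simp
  have le: "gap k * level p (Suc k) s \<le> gap k * s" for k
    by (intro mult_left_mono level_le gap_nonneg)
  show ?thesis
    unfolding spread_def by (rule sums_le[OF le summable_sums[OF summable_spread[OF assms]] gap_s])
qed

text \<open>By monotonicity of \<open>level\<close>, no term of the difference is negative. From
  index \<open>J\<close> on, truncation costs at most half of \<open>s - t\<close>, so each level
  difference is at least \<open>(s - t) / 2\<close>; the weights of these terms add up to
  (1/2)^(J^2).\<close>

lemma spread_diff_ge_at_scale: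
  assumes "0 \<le> t" "t \<le> s" and scale: "2 \<le> 2 ^ (p * (Suc J)\<^sup>2) * (s - t)"
  shows "(s - t) / 2 * (1/2) ^ (J\<^sup>2) \<le> spread p s - spread p t"
proof -
  define h where "h k = gap k * (level p (Suc k) s - level p (Suc k) t)" for k
  have h_nonneg: "0 \<le> h k" for k
    unfolding h_def using assms by (simp add: gap_nonneg level_mono)
  have s: "summable (\<lambda>k. gap k * level p (Suc k) s)" and t: "summable (\<lambda>k. gap k * level p (Suc k) t)"
    using assms summable_spread by auto
  have h_eq: "h = (\<lambda>k. gap k * level p (Suc k) s - gap k * level p (Suc k) t)"
    by (simp add: h_def fun_eq_iff algebra_simps)
  have h_summable: "summable h"
    unfolding h_eq by (rule summable_diff[OF s t])
  have gap_J: "(\<lambda>k. gap (k + J) * ((s - t) / 2)) sums ((1/2) ^ (J\<^sup>2) * ((s - t) / 2))"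
    by (intro sums_mult2 gap_sums)
  have h_ge: "gap (k + J) * ((s - t) / 2) \<le> h (k + J)" for k
  proof -
    have "(2::real) ^ (p * (Suc J)\<^sup>2) \<le> 2 ^ (p * (Suc (k + J))\<^sup>2)"
      by (intro power_increasing mult_left_mono power_mono) auto
    then have "2 ^ (p * (Suc J)\<^sup>2) * (s - t) \<le> 2 ^ (p * (Suc (k + J))\<^sup>2) * (s - t)"
      using assms by (intro mult_right_mono) auto
    with scale have "2 \<le> 2 ^ (p * (Suc (k + J))\<^sup>2) * (s - t)"
      by linarith
    then have "1 / 2 ^ (p * (Suc (k + J))\<^sup>2) \<le> (s - t) / 2"
      by (simp add: field_simps)
    moreover define e :: real where "e = 1 / 2 ^ (p * (Suc (k + J))\<^sup>2)"
    ultimately have "e \<le> (s - t) / 2"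
      by simp
    moreover have "s - e \<le> level p (Suc (k + J)) s"
      unfolding e_def by (rule level_ge)
    moreover have "level p (Suc (k + J)) t \<le> t"
      by (rule level_le)
    ultimately have "(s - t) / 2 \<le> level p (Suc (k + J)) s - level p (Suc (k + J)) t"
      by (simp add: field_simps)
    then show ?thesis
      unfolding h_def by (intro mult_left_mono gap_nonneg)
  qed
  have "(1/2) ^ (J\<^sup>2) * ((s - t) / 2) \<le> (\<Sum>k. h (k + J))"
    by (rule sums_le[OF h_ge gap_J summable_sums[OF summable_ignore_initial_segment[OF h_summable]]])
  also have "\<dots> \<le> (\<Sum>k. h k)"
    using suminf_split_initial_segment[OF h_summable, of J] sum_nonneg[of "{..<J}" h] h_nonneg
    by simp
  also have "\<dots> = spread p s - spread p t"
    unfolding spread_def h_eq by (simp add: suminf_diff[OF s t])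
  finally show ?thesis
    by (simp add: mult.commute)
qed

text \<open>The factor (1/2)^(J^2) lost at the right scale must be paid for by a power of the
  distance. If scale \<open>J\<close> is still too coarse, then \<open>(s - t) / 2\<close> is at
  most 2^(-p J^2), and its power with exponent \<beta> is at most 2^(-J^2) because p \<beta> is at
  least 1.\<close>

lemma spread_diff_ge:
  assumes "0 \<le> t" "t < s" "s < 1" "0 < \<beta>" "1 \<le> real p * \<beta>"
  shows "((s - t) / 2) powr (1 + \<beta>) \<le> spread p s - spread p t"
proof -
  define P where "P k \<longleftrightarrow> 2 \<le> 2 ^ (p * k\<^sup>2) * (s - t)" for k
  have p: "1 \<le> p"
    using assms by (cases p) auto
  obtain k where "2 / (s - t) < 2 ^ k"
    using real_arch_pow[of 2 "2 / (s - t)"] by auto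
  also have "(2::real) ^ k \<le> 2 ^ (p * k\<^sup>2)"
    using p by (intro power_increasing) (auto simp: power2_eq_square)
  finally have "P k"
    unfolding P_def using assms by (simp add: field_simps)
  moreover have "\<not> P 0"
    unfolding P_def using assms by simp
  \<comment> \<open>Consecutive scales: failure at \<open>J\<close> bounds the distance from above,
    success at \<open>Suc J\<close> is what \<open>spread_diff_ge_at_scale\<close> asks for.\<close>
  ultimately obtain J where J: "\<not> P J" "P (Suc J)"
    using ex_least_nat_less[of P k] by auto
  have "(s - t) / 2 \<le> (1/2) ^ (p * J\<^sup>2)"
    using J(1) unfolding P_def by (simp add: field_simps power_divide)
  then have "((s - t) / 2) powr \<beta> \<le> ((1/2) ^ (p * J\<^sup>2)) powr \<beta>"
    using assms by (intro powr_mono2) auto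
  also have "\<dots> = (1/2) powr ((real p * \<beta>) * real (J\<^sup>2))"
    by (simp add: powr_powr flip: powr_realpow) (simp add: mult_ac)
  also have "\<dots> \<le> (1/2) powr (real (J\<^sup>2))"
  proof -
    have "1 * real (J\<^sup>2) \<le> (real p * \<beta>) * real (J\<^sup>2)"
      using assms by (intro mult_right_mono) auto
    then show ?thesis
      by (intro powr_mono') auto
  qed
  also have "\<dots> = (1/2) ^ (J\<^sup>2)"
    by (subst powr_realpow) auto
  finally have "((s - t) / 2) powr \<beta> \<le> (1/2) ^ (J\<^sup>2)" .
  then have "(s - t) / 2 * ((s - t) / 2) powr \<beta> \<le> (s - t) / 2 * (1/2) ^ (J\<^sup>2)"
    using assms by (intro mult_left_mono) auto
  also have "\<dots> \<le> spread p s - spread p t"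
    using assms J(2) by (intro spread_diff_ge_at_scale) (auto simp: P_def)
  finally show ?thesis
    using assms by (simp add: powr_add)
qed

text \<open>The last digit of block \<open>J\<close> lands at place p (J+1)^2 + J^2 of
  \<open>spread p s\<close>. Scaling by this power of 2 makes everything up to there an integer, and
  the 2 J + 1 inserted zeros that follow keep the remainder small.\<close>

lemma spread_near_integer_multiple:
  assumes "0 \<le> s"
  shows "\<exists>m::int. \<bar>2 ^ (p * (Suc J)\<^sup>2 + J\<^sup>2) * spread p s - of_int m\<bar> \<le> (1/2) ^ (2 * J + 1)"
proof -
  define n :: real where "n = 2 ^ (p * (Suc J)\<^sup>2 + J\<^sup>2)"
  define N :: real where "N = 2 ^ (p * (Suc J)\<^sup>2)"
  define f where "f k = gap k * level p (Suc k) s" for k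
  define g where "g k = f (k + J) - gap (k + J) * level p (Suc J) s" for k
  \<comment> \<open>\<open>A\<close> freezes every truncation from index \<open>J\<close> on at
    \<open>level p (Suc J) s\<close>, which drops all later blocks.\<close>
  define A where "A = (\<Sum>k<J. f k) + (1/2) ^ (J\<^sup>2) * level p (Suc J) s"
  have f: "summable f"
    unfolding f_def by (rule summable_spread[OF assms])
  have fJ: "(\<lambda>k. f (k + J)) sums (spread p s - (\<Sum>k<J. f k))"
    using sums_split_initial_segment[OF summable_sums[OF f], of J] by (simp add: spread_def f_def[abs_def])
  have "g sums (spread p s - (\<Sum>k<J. f k) - (1/2) ^ (J\<^sup>2) * level p (Suc J) s)"
    unfolding g_def by (intro sums_diff fJ sums_mult2 gap_sums)
  then have "g sums (spread p s - A)"
    by (simp add: A_def algebra_simps)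
  moreover have "g 0 = 0"
    by (simp add: g_def f_def)
  ultimately have gS: "(\<lambda>k. g (Suc k)) sums (spread p s - A)"
    by (simp add: sums_Suc_iff)
  have bnd: "(\<lambda>k. gap (k + Suc J) * (1 / N)) sums ((1/2) ^ ((Suc J)\<^sup>2) * (1 / N))"
    by (intro sums_mult2 gap_sums)
  have g_le: "norm (g (Suc k)) \<le> gap (k + Suc J) * (1 / N)" for k
  proof -
    have "N \<le> 2 ^ (p * (Suc (Suc k + J))\<^sup>2)"
      unfolding N_def by (intro power_increasing mult_left_mono power_mono) auto
    then have "1 / 2 ^ (p * (Suc (Suc k + J))\<^sup>2) \<le> 1 / N"
      by (intro divide_left_mono) (auto simp: N_def)
    then have "\<bar>level p (Suc (Suc k + J)) s - level p (Suc J) s\<bar> \<le> 1 / N"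
      using level_ge[of s p "Suc (Suc k + J)"] level_le[of p "Suc (Suc k + J)" s]
        level_ge[of s p "Suc J"] level_le[of p "Suc J" s] unfolding N_def by linarith
    then have "gap (k + Suc J) * \<bar>level p (Suc (Suc k + J)) s - level p (Suc J) s\<bar> \<le> gap (k + Suc J) * (1 / N)"
      by (intro mult_left_mono gap_nonneg)
    then show ?thesis
      by (simp add: g_def f_def abs_mult gap_nonneg flip: right_diff_distrib)
  qed
  have "\<bar>spread p s - A\<bar> \<le> (1/2) ^ ((Suc J)\<^sup>2) * (1 / N)"
    using norm_suminf_le[of "\<lambda>k. g (Suc k)", OF g_le] gS bnd by (simp add: sums_iff)
  then have "n * \<bar>spread p s - A\<bar> \<le> n * ((1/2) ^ ((Suc J)\<^sup>2) * (1 / N))"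
    by (intro mult_left_mono) (auto simp: n_def)
  also have "\<dots> = 2 ^ J\<^sup>2 * (1/2) ^ ((Suc J)\<^sup>2)"
    by (simp add: n_def N_def power_add)
  also have "(Suc J)\<^sup>2 = J\<^sup>2 + (2 * J + 1)"
    by (simp add: power2_eq_square)
  also have "(2::real) ^ J\<^sup>2 * (1/2) ^ (J\<^sup>2 + (2 * J + 1)) = (1/2) ^ (2 * J + 1)"
    by (simp only: power_add) (simp add: power_one_over)
  finally have close: "\<bar>n * spread p s - n * A\<bar> \<le> (1/2) ^ (2 * J + 1)"
    by (simp add: n_def abs_mult flip: right_diff_distrib)
  have scale: "2 ^ a * x / 2 ^ b \<in> \<int>" if "b \<le> a" "x \<in> \<int>" for a b and x :: real
  proof -
    have "2 ^ a * x / 2 ^ b = 2 ^ (a - b) * x"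
      using that by (simp add: power_diff)
    with that show ?thesis
      by simp
  qed
  \<comment> \<open>Of the two factors of \<open>n\<close>, 2^(J^2) clears the denominators of
    \<open>gap k\<close> and 2^(p (J+1)^2) that of the truncation.\<close>
  have "n * f k \<in> \<int>" if "k < J" for k
  proof -
    have k: "Suc k \<le> J"
      using that by simp
    have "(2 ^ J\<^sup>2 * 1 / 2 ^ k\<^sup>2 - 2 ^ J\<^sup>2 * 1 / 2 ^ (Suc k)\<^sup>2 :: real) *
        (2 ^ (p * (Suc J)\<^sup>2) * of_int \<lfloor>2 ^ (p * (Suc k)\<^sup>2) * s\<rfloor> / 2 ^ (p * (Suc k)\<^sup>2)) \<in> \<int>"
      using that by (intro Ints_mult Ints_diff scale) (auto intro!: power_mono mult_left_mono)
    also have "(2 ^ J\<^sup>2 * 1 / 2 ^ k\<^sup>2 - 2 ^ J\<^sup>2 * 1 / 2 ^ (Suc k)\<^sup>2 :: real) *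
        (2 ^ (p * (Suc J)\<^sup>2) * of_int \<lfloor>2 ^ (p * (Suc k)\<^sup>2) * s\<rfloor> / 2 ^ (p * (Suc k)\<^sup>2)) = n * f k"
      unfolding n_def f_def gap_def level_def
      by (simp only: power_add power_one_over) (simp add: algebra_simps diff_divide_distrib)
    finally show ?thesis .
  qed
  then have "(\<Sum>k<J. n * f k) \<in> \<int>"
    by (intro Ints_sum) auto
  moreover have "n * ((1/2) ^ (J\<^sup>2) * level p (Suc J) s) = of_int \<lfloor>2 ^ (p * (Suc J)\<^sup>2) * s\<rfloor>"
    by (simp add: n_def level_def power_add power_one_over)
  ultimately have "n * A \<in> \<int>"
    unfolding A_def by (simp only: distrib_left sum_distrib_left) (intro Ints_add Ints_of_int)
  then obtain m where "n * A = of_int m"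
    by (auto elim: Ints_cases)
  with close show ?thesis
    unfolding n_def by auto
qed

lemma abs_sin_le_near_integer:
  assumes "\<bar>y - of_int m\<bar> \<le> e"
  shows "\<bar>sin (2 * pi * y)\<bar> \<le> 2 * pi * e"
proof -
  have "sin (2 * pi * y) = sin (2 * pi * (y - of_int m) + 2 * pi * of_int m)"
    by (simp add: algebra_simps)
  also have "\<dots> = sin (2 * pi * (y - of_int m))"
    using sin_cos_eq_iff[of "2 * pi * (y - of_int m) + 2 * pi * of_int m" "2 * pi * (y - of_int m)"]
    by (metis mult.commute)
  finally have "\<bar>sin (2 * pi * y)\<bar> \<le> \<bar>2 * pi * (y - of_int m)\<bar>"
    by (simp add: abs_sin_x_le_abs_x del: abs_mult)
  also have "\<dots> \<le> 2 * pi * e"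
    using assms by (simp add: abs_mult)
  finally show ?thesis .
qed

section \<open>Positive content of an image\<close>

text \<open>Two points of a ball of radius r are less than 2 r apart, so by \<open>sep\<close> the
  preimage of the ball fits into an interval of length 2 C r^\<alpha>. These intervals cover the
  unit interval, and subadditivity of Lebesgue measure bounds every covering sum below by 1 / (2
  C).\<close>

lemma hausdorff_content_image_pos:
  fixes f :: "real \<Rightarrow> real"
  assumes "0 < C"
    and sep: "\<And>s t r. s \<in> {0..<1} \<Longrightarrow> t \<in> {0..<1} \<Longrightarrow> \<bar>f s - f t\<bar> < 2 * r \<Longrightarrow>
      \<bar>s - t\<bar> \<le> C * r powr \<alpha>"
  shows "0 < hausdorff_content \<alpha> (f ` {0..<1})"
proof -
  have main: "1 \<le> ennreal (2 * C) * (\<Sum>j. ennreal (r j powr \<alpha>))"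
    if cover: "f ` {0..<1} \<subseteq> (\<Union>j. ball (x j) (r j))" for x r :: "nat \<Rightarrow> real"
  proof -
    have "\<forall>j. \<exists>c. {s \<in> {0..<1}. f s \<in> ball (x j) (r j)} \<subseteq> {c - C * r j powr \<alpha>..c + C * r j powr \<alpha>}"
    proof
      fix j
      show "\<exists>c. {s \<in> {0..<1}. f s \<in> ball (x j) (r j)} \<subseteq> {c - C * r j powr \<alpha>..c + C * r j powr \<alpha>}"
      \<comment> \<open>Any preimage point serves as the centre; if the preimage is empty, any real
        does.\<close>
      proof (cases "\<exists>c\<in>{0..<1}. f c \<in> ball (x j) (r j)")
        case True
        then obtain c where c: "c \<in> {0..<1}" "f c \<in> ball (x j) (r j)"
          by blast
        have "s \<in> {c - C * r j powr \<alpha>..c + C * r j powr \<alpha>}"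
          if "s \<in> {0..<1}" "f s \<in> ball (x j) (r j)" for s
        proof -
          have "\<bar>f s - f c\<bar> < 2 * r j"
            using that(2) c(2) by (simp add: dist_real_def)
          from sep[OF that(1) c(1) this] show ?thesis
            by auto
        qed
        then show ?thesis
          by blast
      qed auto
    qed
    then obtain c where
      c: "\<And>j. {s \<in> {0..<1}. f s \<in> ball (x j) (r j)} \<subseteq> {c j - C * r j powr \<alpha>..c j + C * r j powr \<alpha>}"
      by metis
    have "{0..<1::real} \<subseteq> (\<Union>j. {c j - C * r j powr \<alpha>..c j + C * r j powr \<alpha>})"
      using cover c by blast
    then have "emeasure lborel {0..<1::real} \<le>
        emeasure lborel (\<Union>j. {c j - C * r j powr \<alpha>..c j + C * r j powr \<alpha>})"
      by (intro emeasure_mono) auto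
    also have "\<dots> \<le> (\<Sum>j. emeasure lborel {c j - C * r j powr \<alpha>..c j + C * r j powr \<alpha>})"
      by (intro emeasure_subadditive_countably) auto
    also have "\<dots> = (\<Sum>j. ennreal (2 * C) * ennreal (r j powr \<alpha>))"
      using \<open>0 < C\<close> by (simp add: mult.assoc flip: ennreal_mult)
    also have "\<dots> = ennreal (2 * C) * (\<Sum>j. ennreal (r j powr \<alpha>))"
      by simp
    finally show ?thesis
      by simp
  qed
  have "ennreal (1 / (2 * C)) \<le> hausdorff_content \<alpha> (f ` {0..<1})"
    unfolding hausdorff_content_def
  proof (intro INF_greatest, clarify)
    fix x r :: "nat \<Rightarrow> real"
    assume "f ` {0..<1} \<subseteq> (\<Union>j. ball (x j) (r j))"
    from main[OF this]
    have "ennreal (1 / (2 * C)) * 1 \<le> ennreal (1 / (2 * C)) * (ennreal (2 * C) * (\<Sum>j. ennreal (r j powr \<alpha>)))"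
      by (rule mult_left_mono) simp
    also have "\<dots> = (\<Sum>j. ennreal (r j powr \<alpha>))"
      using \<open>0 < C\<close> by (simp add: mult.assoc[symmetric] flip: ennreal_mult)
    finally show "ennreal (1 / (2 * C)) \<le> (\<Sum>j. ennreal (r j powr \<alpha>))"
      by simp
  qed
  moreover have "0 < ennreal (1 / (2 * C))"
    using \<open>0 < C\<close> by (simp add: ennreal_zero_less_divide)
  ultimately show ?thesis
    by (rule less_le_trans[rotated])
qed

section \<open>Stationary sine solutions\<close>

lemma smooth_torus_fun_sin: "smooth_torus_fun (\<lambda>x. complex_of_real (sin (real n * x)))"
  unfolding smooth_torus_fun_def torus_fun_def
\<comment> \<open>Writing each derivative as a phase shift by \<open>pi / 2\<close> gives one
  formula for all orders.\<close>
proof (intro conjI allI exI[of _ "\<lambda>k x. complex_of_real (real n ^ k * sin (real n * x + real k * (pi / 2)))"])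
  fix x
  have "sin (real n * (x + 2 * pi)) = sin (real n * x + 2 * pi * real n)"
    by (simp add: algebra_simps)
  then show "complex_of_real (sin (real n * (x + 2 * pi))) = complex_of_real (sin (real n * x))"
    using sin_2npi[of n] cos_2npi[of n] by (simp add: sin_add mult_ac)
next
  fix k x
  have "sin (real n * x + real (Suc k) * (pi / 2)) = cos (real n * x + real k * (pi / 2))"
    using sin_add[of "real n * x + real k * (pi / 2)" "pi / 2"] by (simp add: algebra_simps add_divide_distrib)
  moreover have "((\<lambda>x. real n ^ k * sin (real n * x + real k * (pi / 2))) has_real_derivative
      real n ^ Suc k * cos (real n * x + real k * (pi / 2))) (at x)"
    by (auto intro!: derivative_eq_intros)
  ultimately show "((\<lambda>x. complex_of_real (real n ^ k * sin (real n * x + real k * (pi / 2)))) has_vector_derivative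
      complex_of_real (real n ^ Suc k * sin (real n * x + real (Suc k) * (pi / 2)))) (at x)"
    by (intro has_vector_derivative_of_real) simp
qed simp

text \<open>Time enters only through a factor of modulus 1, so the modulus is constant in time; the
  sine, unlike a complex exponential, vanishes on the grid of multiples of pi / n.\<close>

lemma schroedinger_solution_sin:
  "schroedinger_solution (\<lambda>x. complex_of_real (sin (real n * x)))
     (\<lambda>t x. cis (- (real n)\<^sup>2 * t) * complex_of_real (sin (real n * x)))"
proof -
  define u where "u t x = cis (- (real n)\<^sup>2 * t) * complex_of_real (sin (real n * x))" for t x
  define ut where "ut t x = - (\<i> * complex_of_real ((real n)\<^sup>2)) * u t x" for t x
  define ux where
    "ux t x = cis (- (real n)\<^sup>2 * t) * complex_of_real (real n * cos (real n * x))" for t x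
  define uxx where "uxx t x = - complex_of_real ((real n)\<^sup>2) * u t x" for t x
  have per: "torus_fun (u t)" for t
    using smooth_torus_fun_sin[of n] by (simp add: u_def torus_fun_def smooth_torus_fun_def)
  have cont: "continuous_on S (\<lambda>(t, x). u t x)" "continuous_on S (\<lambda>(t, x). ut t x)"
    "continuous_on S (\<lambda>(t, x). ux t x)" "continuous_on S (\<lambda>(t, x). uxx t x)" for S
    unfolding u_def ut_def ux_def uxx_def case_prod_unfold cis_conv_exp
    by (intro continuous_intros)+
  have dt: "((\<lambda>s. u s x) has_vector_derivative ut t x) (at t)" for t x
  proof -
    have "(cis has_vector_derivative \<i> * cis (- (real n)\<^sup>2 * t)) (at (- (real n)\<^sup>2 * t))"
      unfolding has_vector_derivative_def
      by (auto intro!: derivative_eq_intros simp: fun_eq_iff scaleR_conv_of_real mult_ac)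
    moreover have "((\<lambda>s. - (real n)\<^sup>2 * s) has_vector_derivative - (real n)\<^sup>2) (at t)"
      by (auto intro!: derivative_eq_intros simp flip: has_real_derivative_iff_has_vector_derivative)
    ultimately have "((\<lambda>s. cis (- (real n)\<^sup>2 * s)) has_vector_derivative
        - (real n)\<^sup>2 *\<^sub>R (\<i> * cis (- (real n)\<^sup>2 * t))) (at t)"
      using vector_diff_chain_at[of "\<lambda>s. - (real n)\<^sup>2 * s" "- (real n)\<^sup>2" t cis] by (simp add: o_def)
    from has_vector_derivative_mult_left[OF this, of "complex_of_real (sin (real n * x))"]
    show ?thesis
      by (simp add: u_def ut_def scaleR_conv_of_real mult_ac)
  qed
  have dx: "(u t has_vector_derivative ux t x) (at x)" for t x
  proof -
    have "((\<lambda>x. sin (real n * x)) has_real_derivative real n * cos (real n * x)) (at x)"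
      by (auto intro!: derivative_eq_intros)
    then show ?thesis
      unfolding u_def ux_def by (intro has_vector_derivative_mult_right has_vector_derivative_of_real)
  qed
  have dxx: "(ux t has_vector_derivative uxx t x) (at x)" for t x
  proof -
    have "((\<lambda>x. real n * cos (real n * x)) has_real_derivative - (real n)\<^sup>2 * sin (real n * x)) (at x)"
      by (auto intro!: derivative_eq_intros simp: power2_eq_square)
    then have "(ux t has_vector_derivative cis (- (real n)\<^sup>2 * t) *
        complex_of_real (- (real n)\<^sup>2 * sin (real n * x))) (at x)"
      unfolding ux_def by (intro has_vector_derivative_mult_right has_vector_derivative_of_real)
    then show ?thesis
      by (simp add: uxx_def u_def mult_ac)
  qed
  have eq: "\<i> * ut t x + uxx t x = 0" for t x
    by (simp add: ut_def uxx_def flip: mult.assoc)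
  have "schroedinger_solution (\<lambda>x. complex_of_real (sin (real n * x))) u"
    unfolding schroedinger_solution_def
  proof (intro conjI, goal_cases)
    case 3
    show ?case
      by (simp add: u_def)
  next
    case 4
    show ?case
      by (rule exI[of _ ut], rule exI[of _ ux], rule exI[of _ uxx]) (use cont dt dx dxx eq in auto)
  qed (use per cont in auto)
  then show ?thesis
    by (simp add: u_def[abs_def])
qed

lemma torus_L2_norm_sin:
  assumes "0 < n"
  shows "torus_L2_norm (\<lambda>x. cis a * complex_of_real (sin (real n * x))) = sqrt pi"
proof -
  \<comment> \<open>Antiderivative obtained from sin^2 y = (1 - cos (2 y)) / 2.\<close>
  define F where "F x = x / 2 - sin (real (2 * n) * x) / real (4 * n)" for x
  have "((\<lambda>x. (sin (real n * x))\<^sup>2) has_integral (F (2 * pi) - F 0)) {0..2 * pi}"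
  proof (rule fundamental_theorem_of_calculus)
    fix x
    have "cos (real (2 * n) * x) = 1 - 2 * (sin (real n * x))\<^sup>2"
      using cos_double_sin[of "real n * x"] by (simp add: mult_ac)
    then have "(F has_real_derivative (sin (real n * x))\<^sup>2) (at x)"
      unfolding F_def using assms by (auto intro!: derivative_eq_intros simp: diff_divide_distrib)
    then show "(F has_vector_derivative (sin (real n * x))\<^sup>2) (at x within {0..2 * pi})"
      by (simp add: has_real_derivative_iff_has_vector_derivative has_vector_derivative_at_within)
  qed simp
  moreover have "sin (real (2 * n) * (2 * pi)) = 0"
    using sin_npi[of "4 * n"] by (simp add: mult_ac)
  ultimately show ?thesis
    by (simp add: torus_L2_norm_def norm_mult F_def integral_unique)
qed

section \<open>Failure of observability on the Cantor set\<close>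

theorem theorem1p5:
  fixes \<alpha> T :: real
  assumes "0 < \<alpha>" and "\<alpha> < 1" and "0 < T"
  shows "\<not> (\<forall>E \<subseteq> {0..<2 * pi}. hausdorff_content \<alpha> E > 0 \<longrightarrow>
            (\<exists>C_obs > 0. \<forall>u0 u.
               smooth_torus_fun u0 \<longrightarrow> schroedinger_solution u0 u \<longrightarrow>
               torus_L2_norm (u T) \<le> C_obs * integral {0..T} (\<lambda>t. SUP x\<in>E. cmod (u t x))))"
proof
  assume obs: "\<forall>E \<subseteq> {0..<2 * pi}. hausdorff_content \<alpha> E > 0 \<longrightarrow>
            (\<exists>C_obs > 0. \<forall>u0 u.
               smooth_torus_fun u0 \<longrightarrow> schroedinger_solution u0 u \<longrightarrow>
               torus_L2_norm (u T) \<le> C_obs * integral {0..T} (\<lambda>t. SUP x\<in>E. cmod (u t x)))"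
  define \<beta> where "\<beta> = 1 / \<alpha> - 1"
  have \<beta>: "0 < \<beta>" "1 + \<beta> = 1 / \<alpha>"
    using assms by (simp_all add: \<beta>_def)
  \<comment> \<open>A large \<open>p\<close> makes the inserted zeros sparse enough for the
    separation exponent 1 + \<beta> = 1 / \<alpha>.\<close>
  obtain p :: nat where "1 / \<beta> < real p"
    using reals_Archimedean2 by blast
  then have p: "1 \<le> real p * \<beta>"
    using \<beta> by (simp add: field_simps)
  define f where "f s = 2 * pi * spread p s" for s
  have ordered: "s - t \<le> 2 * r powr \<alpha>" if "0 \<le> t" "t < s" "s < 1" "f s - f t < 2 * r" for s t r
  proof -
    have "((s - t) / 2) powr (1 / \<alpha>) \<le> spread p s - spread p t"
      using spread_diff_ge[OF that(1-3) \<beta>(1) p] by (simp add: \<beta>)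
    \<comment> \<open>Bounding 2 pi below by 2 cancels the 2 of \<open>2 * r\<close>; the power
      \<alpha> then inverts 1 / \<alpha> and leaves the constant 2.\<close>
    then have "2 * ((s - t) / 2) powr (1 / \<alpha>) \<le> 2 * pi * (spread p s - spread p t)"
      using pi_gt3 by (intro mult_mono) auto
    also have "\<dots> < 2 * r"
      using that(4) by (simp add: f_def algebra_simps)
    finally have "(((s - t) / 2) powr (1 / \<alpha>)) powr \<alpha> \<le> r powr \<alpha>"
      using assms by (intro powr_mono2) auto
    then show ?thesis
      using assms that by (simp add: powr_powr)
  qed
  have "\<bar>s - t\<bar> \<le> 2 * r powr \<alpha>"
    if "s \<in> {0..<1}" "t \<in> {0..<1}" "\<bar>f s - f t\<bar> < 2 * r" for s t r
    using ordered[of t s r] ordered[of s t r] that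
    by (cases s t rule: linorder_cases) auto
  then have "0 < hausdorff_content \<alpha> (f ` {0..<1})"
    by (intro hausdorff_content_image_pos[of 2]) auto
  \<comment> \<open>The weights sum to 1, so \<open>spread p s\<close> stays between 0 and
    \<open>s\<close>.\<close>
  moreover have "f ` {0..<1} \<subseteq> {0..<2 * pi}"
    using spread_nonneg spread_le by (fastforce simp: f_def intro: le_less_trans)
  ultimately obtain C where C: "0 < C" and
    obs_C: "\<And>u0 u. smooth_torus_fun u0 \<Longrightarrow> schroedinger_solution u0 u \<Longrightarrow>
      torus_L2_norm (u T) \<le> C * integral {0..T} (\<lambda>t. SUP x\<in>f ` {0..<1}. cmod (u t x))"
    using obs by meson
  have bound: "sqrt pi \<le> C * (T * (2 * pi * (1/2) ^ (2 * J + 1)))" for J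
  proof -
    define n :: nat where "n = 2 ^ (p * (Suc J)\<^sup>2 + J\<^sup>2)"
    define u where "u = (\<lambda>t x. cis (- (real n)\<^sup>2 * t) * complex_of_real (sin (real n * x)))"
    \<comment> \<open>The factor 2 pi in \<open>f\<close> puts \<open>n * f s\<close> close to a
      multiple of 2 pi.\<close>
    have "\<bar>sin (real n * f s)\<bar> \<le> 2 * pi * (1/2) ^ (2 * J + 1)" if s: "s \<in> {0..<1}" for s
    proof -
      obtain m where "\<bar>real n * spread p s - of_int m\<bar> \<le> (1/2) ^ (2 * J + 1)"
        using spread_near_integer_multiple[of s p J] s by (auto simp: n_def)
      from abs_sin_le_near_integer[OF this] show ?thesis
        by (simp add: f_def mult_ac)
    qed
    then have "(SUP x\<in>f ` {0..<1}. \<bar>sin (real n * x)\<bar>) \<le> 2 * pi * (1/2) ^ (2 * J + 1)"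
      by (intro cSUP_least) auto
    then have "C * (T * (SUP x\<in>f ` {0..<1}. \<bar>sin (real n * x)\<bar>)) \<le> C * (T * (2 * pi * (1/2) ^ (2 * J + 1)))"
      using C assms by (intro mult_left_mono) auto
    \<comment> \<open>The phase drops out of the modulus, so the integrand is constant in
      \<open>t\<close>.\<close>
    moreover have "integral {0..T} (\<lambda>t. SUP x\<in>f ` {0..<1}. cmod (u t x)) =
        T * (SUP x\<in>f ` {0..<1}. \<bar>sin (real n * x)\<bar>)"
      using assms by (simp add: u_def norm_mult)
    moreover have "torus_L2_norm (u T) = sqrt pi"
      unfolding u_def by (rule torus_L2_norm_sin) (simp add: n_def)
    moreover have "torus_L2_norm (u T) \<le> C * integral {0..T} (\<lambda>t. SUP x\<in>f ` {0..<1}. cmod (u t x))"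
      using obs_C[OF smooth_torus_fun_sin[of n] schroedinger_solution_sin[of n]]
      unfolding u_def .
    ultimately show ?thesis
      by (simp only:)
  qed
  \<comment> \<open>\<open>C\<close> belongs to the set and does not depend on \<open>J\<close>, so
    \<open>J\<close> may tend to infinity in \<open>bound\<close>.\<close>
  have "(\<lambda>J. C * (T * (2 * pi * ((1/4) ^ J * (1/2))))) \<longlonglongrightarrow> C * (T * (2 * pi * (0 * (1/2))))"
    by (intro tendsto_intros LIMSEQ_power_zero) simp
  moreover have "(1/2::real) ^ (2 * J + 1) = (1/4) ^ J * (1/2)" for J
    by (simp add: power_mult power_divide)
  ultimately have "sqrt pi \<le> 0"
    using bound by (intro LIMSEQ_le_const[of _ 0]) auto
  then show False
    using pi_gt_zero by simp
qed

end
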